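(* Let $A$ and $B$ be abelian groups and let $a\in A$. There is an isomorphism of elliptic groups $$({}_1\mathbb{Z}\times {}_0B)\coprod {}_aA\cong {}_{(0,0,a)}(\mathbb{Z}\oplus B\oplus A).$$ More precisely, the maps $i:{}_1\mathbb{Z}\times {}_0B\to {}_{(0,0,a)}(\mathbb{Z}\oplus B\oplus A)$, $i(n,b)=(1-3n,b,na)$, and $j:{}_aA\to {}_{(0,0,a)}(\mathbb{Z}\oplus B\oplus A)$, $j(x)=(0,0,x)$, are morphisms of elliptic groups forming a coproduct diagram of elliptic groups: for any elliptic group $E$ and any morphisms of elliptic groups $f:{}_1\mathbb{Z}\times {}_0B\to E$ and $g:{}_aA\to E$, there exists a unique morphism of elliptic groups $h:{}_{(0,0,a)}(\mathbb{Z}\oplus B\oplus A)\to E$ such that $f=h\circ i$ and $g=h\circ j$.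
   Context: An elliptic group is a set $S$ (possibly empty) with a binary operation $\ast$ satisfying, for all $x,y,z,w\in S$: (EG1) $x\ast y=y\ast x$; (EG2) $x\ast(x\ast y)=y$; (EG3) $x\ast(y\ast(z\ast w))=w\ast(y\ast(z\ast x))$. A morphism of elliptic groups $f:S\to T$ is a map with $f(x\ast y)=f(x)\ast f(y)$ for all $x,y$; an isomorphism is a bijective morphism. For an (additive) abelian group $A$ and $a\in A$, ${}_aA$ denotes the elliptic group with underlying set $A$ and operation $x\ast_a y=a-x-y$. $\times$ is the product of elliptic groups (componentwise operation), $\oplus$ the direct sum of abelian groups, and $\coprod$ the coproduct in the category of elliptic groups. *)

theory Defs
  imports "HOL-Algebra.Elementary_Groups"
begin

record 'a elliptic = "'a partial_object" +
  eop :: "'a \<Rightarrow> 'a \<Rightarrow> 'a" (infixl "\<star>\<index>" 70)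

locale elliptic_group =
  fixes S (structure)
  assumes closed: "x \<in> carrier S \<Longrightarrow> y \<in> carrier S \<Longrightarrow> x \<star> y \<in> carrier S"
    and EG1: "x \<in> carrier S \<Longrightarrow> y \<in> carrier S \<Longrightarrow> x \<star> y = y \<star> x"
    and EG2: "x \<in> carrier S \<Longrightarrow> y \<in> carrier S \<Longrightarrow> x \<star> (x \<star> y) = y"
    and EG3: "x \<in> carrier S \<Longrightarrow> y \<in> carrier S \<Longrightarrow> z \<in> carrier S \<Longrightarrow> w \<in> carrier S
      \<Longrightarrow> x \<star> (y \<star> (z \<star> w)) = w \<star> (y \<star> (z \<star> x))"

definition elliptic_hom :: "('a, 'm) elliptic_scheme \<Rightarrow> ('b, 'n) elliptic_scheme \<Rightarrow> ('a \<Rightarrow> 'b) set"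
  where "elliptic_hom S T = {f \<in> carrier S \<rightarrow> carrier T.
    \<forall>x\<in>carrier S. \<forall>y\<in>carrier S. f (x \<star>\<^bsub>S\<^esub> y) = f x \<star>\<^bsub>T\<^esub> f y}"

definition elliptic_iso :: "('a, 'm) elliptic_scheme \<Rightarrow> ('b, 'n) elliptic_scheme \<Rightarrow> ('a \<Rightarrow> 'b) set"
  where "elliptic_iso S T = {f \<in> elliptic_hom S T. bij_betw f (carrier S) (carrier T)}"

definition elliptic_prod ::
    "('a, 'm) elliptic_scheme \<Rightarrow> ('b, 'n) elliptic_scheme \<Rightarrow> ('a \<times> 'b) elliptic"
  where "elliptic_prod S T =
    \<lparr>carrier = carrier S \<times> carrier T,
     eop = (\<lambda>(s, t) (s', t'). (s \<star>\<^bsub>S\<^esub> s', t \<star>\<^bsub>T\<^esub> t'))\<rparr>"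

text \<open>For an abelian group \<open>A\<close>, written multiplicatively as in HOL-Algebra, \<open>twist A a\<close>
  is the elliptic group with additive operation \<open>a - x - y\<close>.\<close>

definition twist :: "('a, 'm) monoid_scheme \<Rightarrow> 'a \<Rightarrow> 'a elliptic"
  where "twist A a =
    \<lparr>carrier = carrier A,
     eop = (\<lambda>x y. a \<otimes>\<^bsub>A\<^esub> inv\<^bsub>A\<^esub> x \<otimes>\<^bsub>A\<^esub> inv\<^bsub>A\<^esub> y)\<rparr>"

text \<open>\<open>C\<close> with injections \<open>i\<close>, \<open>j\<close> is a coproduct of \<open>P\<close> and \<open>Q\<close>. HOL cannot quantify over
  types inside a formula, so the type \<open>'e\<close> of the test objects \<open>E\<close> is a parameter; the
  categorical notion is this predicate for all \<open>'e\<close>. Functions are total in HOL, so the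
  mediating morphism is unique among those that are \<open>undefined\<close> outside \<open>carrier C\<close>,
  that is, unique as a map on \<open>carrier C\<close>.\<close>

definition is_elliptic_coproduct ::
    "'e itself \<Rightarrow> 'p elliptic \<Rightarrow> 'q elliptic \<Rightarrow> 'c elliptic \<Rightarrow> ('p \<Rightarrow> 'c) \<Rightarrow> ('q \<Rightarrow> 'c) \<Rightarrow> bool"
  where "is_elliptic_coproduct _ P Q C i j \<longleftrightarrow>
    elliptic_group P \<and> elliptic_group Q \<and> elliptic_group C \<and>
    i \<in> elliptic_hom P C \<and> j \<in> elliptic_hom Q C \<and>
    (\<forall>(E :: 'e elliptic) f g.
      elliptic_group E \<and> f \<in> elliptic_hom P E \<and> g \<in> elliptic_hom Q E \<longrightarrow>
      (\<exists>!h. h \<in> elliptic_hom C E \<and> h \<in> extensional (carrier C) \<and>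
        (\<forall>x\<in>carrier P. f x = h (i x)) \<and> (\<forall>y\<in>carrier Q. g y = h (j y))))"

end

theory Submission
  imports Defs
begin

text \<open>
  A point \<open>p\<close> of an elliptic group \<open>E\<close> makes \<open>E\<close> an abelian group \<open>G\<close> with zero \<open>p\<close> and
  \<open>x + y = p \<star> (x \<star> y)\<close>, and then \<open>x \<star> y = e - x - y\<close> with \<open>e = p \<star> p\<close>; morphisms become
  homomorphisms of these groups. Taking the base point \<open>g 0\<close> of \<open>E\<close>, the map \<open>g\<close> is a
  homomorphism with \<open>g a = e\<close>, and \<open>k = f - f (0, 0)\<close> is a homomorphism \<open>\<int> \<oplus> B \<rightarrow> G\<close> with
  \<open>k (1, 0) = e - 3 f (0, 0)\<close>. The conditions on \<open>h\<close> force
  \<open>h (n, b, x) = n f (0, 0) + k (0, b) + g x\<close>, and this map satisfies them.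
\<close>

lemma (in comm_group) mult_inv_diff_diff:
  assumes "a \<in> carrier G" "d \<in> carrier G" "x \<in> carrier G" "y \<in> carrier G"
  shows "a \<otimes> d \<otimes> inv (a \<otimes> inv x \<otimes> inv y) = d \<otimes> x \<otimes> y"
proof -
  have "inv (a \<otimes> inv x \<otimes> inv y) = inv a \<otimes> (x \<otimes> y)"
    using assms by (simp add: inv_mult m_assoc)
  then have "a \<otimes> d \<otimes> inv (a \<otimes> inv x \<otimes> inv y) = d \<otimes> (a \<otimes> (inv a \<otimes> (x \<otimes> y)))"
    using assms by (simp add: m_ac)
  also have "\<dots> = d \<otimes> x \<otimes> y"
    using assms by (simp add: inv_solve_left' m_assoc flip: m_assoc[of a])
  finally show ?thesis .
qed

lemma comm_group_DirProd:
  assumes "comm_group G" "comm_group H"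
  shows "comm_group (G \<times>\<times> H)"
proof -
  interpret G: comm_group G by fact
  interpret H: comm_group H by fact
  show ?thesis
    by (rule group.group_comm_groupI[OF DirProd_group])
      (auto simp: G.m_comm H.m_comm G.group_axioms H.group_axioms)
qed

definition translation_group :: "('a, 'm) elliptic_scheme \<Rightarrow> 'a \<Rightarrow> 'a monoid"
  where "translation_group S p =
    \<lparr>carrier = carrier S, mult = (\<lambda>x y. p \<star>\<^bsub>S\<^esub> (x \<star>\<^bsub>S\<^esub> y)), one = p\<rparr>"

lemma translation_group_simps [simp]:
  "carrier (translation_group S p) = carrier S"
  "x \<otimes>\<^bsub>translation_group S p\<^esub> y = p \<star>\<^bsub>S\<^esub> (x \<star>\<^bsub>S\<^esub> y)"
  "\<one>\<^bsub>translation_group S p\<^esub> = p"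
  by (simp_all add: translation_group_def)

context elliptic_group
begin

lemma comm_group_translation_group:
  assumes p: "p \<in> carrier S"
  shows "comm_group (translation_group S p)"
proof (rule comm_groupI; simp only: translation_group_simps)
  fix x y z assume xyz: "x \<in> carrier S" "y \<in> carrier S" "z \<in> carrier S"
  show "p \<star> (x \<star> y) \<in> carrier S" "p \<star> (x \<star> y) = p \<star> (y \<star> x)"
    using p xyz by (simp_all add: closed EG1[of x y])
  have "(p \<star> (x \<star> y)) \<star> z = z \<star> (p \<star> (y \<star> x))"
    using p xyz by (metis closed EG1)
  also have "\<dots> = x \<star> (p \<star> (y \<star> z))"
    using p xyz by (simp add: EG3[of z p y x])
  finally show "p \<star> ((p \<star> (x \<star> y)) \<star> z) = p \<star> (x \<star> (p \<star> (y \<star> z)))" by simp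
next
  fix x assume x: "x \<in> carrier S"
  show "p \<star> (p \<star> x) = x" using p x by (rule EG2)
  have "p \<star> (((p \<star> p) \<star> x) \<star> x) = p \<star> (x \<star> (x \<star> (p \<star> p)))"
    using p x by (metis closed EG1)
  also have "\<dots> = p" using p x by (simp add: EG2 closed)
  finally show "\<exists>y\<in>carrier S. p \<star> (y \<star> x) = p" using p x closed by blast
qed (fact p)

lemma op_eq_translation_group:
  assumes p: "p \<in> carrier S" and x: "x \<in> carrier S" and y: "y \<in> carrier S"
  defines "G \<equiv> translation_group S p"
  shows "x \<star> y = (p \<star> p) \<otimes>\<^bsub>G\<^esub> inv\<^bsub>G\<^esub> x \<otimes>\<^bsub>G\<^esub> inv\<^bsub>G\<^esub> y"
proof -
  interpret G: comm_group G unfolding G_def using p by (rule comm_group_translation_group)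
  have mult: "u \<otimes>\<^bsub>G\<^esub> v = p \<star> (u \<star> v)" for u v by (simp add: G_def)
  have G: "x \<in> carrier G" "y \<in> carrier G" "x \<star> y \<in> carrier G" "p \<star> p \<in> carrier G"
    using p x y by (simp_all add: G_def closed)
  have "(x \<star> y) \<star> (p \<star> (x \<star> y)) = p"
    using p x y by (metis closed EG1 EG2)
  then have "(x \<star> y) \<otimes>\<^bsub>G\<^esub> (x \<otimes>\<^bsub>G\<^esub> y) = p \<star> p" by (simp add: mult)
  then have "x \<star> y = (p \<star> p) \<otimes>\<^bsub>G\<^esub> inv\<^bsub>G\<^esub> (x \<otimes>\<^bsub>G\<^esub> y)"
    using G by (metis G.inv_solve_right G.m_closed)
  then show ?thesis using G by (simp add: G.inv_mult G.m_assoc)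
qed

lemma translation_group_hom:
  assumes p: "p \<in> carrier S" and q: "q \<in> carrier S"
  defines "G \<equiv> translation_group S p"
  shows "(\<lambda>x. x \<otimes>\<^bsub>G\<^esub> inv\<^bsub>G\<^esub> q) \<in> hom (translation_group S q) G"
proof -
  interpret G: comm_group G unfolding G_def using p by (rule comm_group_translation_group)
  have carr: "carrier S = carrier G" by (simp add: G_def)
  note op = op_eq_translation_group[OF p, folded G_def, unfolded carr]
  have pp: "p \<star> p \<in> carrier G" using p closed by (simp add: G_def)
  have "q \<star> (x \<star> y) = inv\<^bsub>G\<^esub> q \<otimes>\<^bsub>G\<^esub> x \<otimes>\<^bsub>G\<^esub> y" if "x \<in> carrier G" "y \<in> carrier G" for x y
  proof -
    have "q \<star> (x \<star> y) = (p \<star> p) \<otimes>\<^bsub>G\<^esub> inv\<^bsub>G\<^esub> q \<otimes>\<^bsub>G\<^esub> inv\<^bsub>G\<^esub> (x \<star> y)"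
      using that q closed unfolding carr by (intro op)
    then show ?thesis
      using that q pp by (simp add: op[OF that] G.mult_inv_diff_diff carr)
  qed
  then show ?thesis
    using q unfolding hom_def by (auto simp: carr G.m_ac)
qed

end

lemma elliptic_hom_imp_hom:
  assumes "f \<in> elliptic_hom S T" "p \<in> carrier S" "elliptic_group S"
  shows "f \<in> hom (translation_group S p) (translation_group T (f p))"
  using assms unfolding elliptic_hom_def hom_def by (auto simp: elliptic_group.closed)

lemma twist_simps [simp]:
  "carrier (twist A a) = carrier A"
  "x \<star>\<^bsub>twist A a\<^esub> y = a \<otimes>\<^bsub>A\<^esub> inv\<^bsub>A\<^esub> x \<otimes>\<^bsub>A\<^esub> inv\<^bsub>A\<^esub> y"
  by (simp_all add: twist_def)

lemma elliptic_prod_simps [simp]: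
  "carrier (elliptic_prod S T) = carrier S \<times> carrier T"
  "(s, t) \<star>\<^bsub>elliptic_prod S T\<^esub> (s', t') = (s \<star>\<^bsub>S\<^esub> s', t \<star>\<^bsub>T\<^esub> t')"
  by (simp_all add: elliptic_prod_def)

lemma elliptic_group_twist:
  assumes "comm_group A" "a \<in> carrier A"
  shows "elliptic_group (twist A a)"
proof -
  interpret comm_group A by fact
  show ?thesis
    using assms(2)
    by unfold_locales (simp_all add: mult_inv_diff_diff, simp_all add: inv_mult m_ac)
qed

lemma elliptic_group_prod:
  assumes "elliptic_group S" "elliptic_group T"
  shows "elliptic_group (elliptic_prod S T)"
proof -
  interpret S: elliptic_group S by fact
  interpret T: elliptic_group T by fact
  show ?thesis
    by unfold_locales
      (auto intro: S.closed T.closed S.EG1 T.EG1 S.EG2 T.EG2 S.EG3 T.EG3)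
qed

lemma translation_group_twist_mult:
  assumes "comm_group A" "a \<in> carrier A" "x \<in> carrier A" "y \<in> carrier A"
  shows "x \<otimes>\<^bsub>translation_group (twist A a) \<one>\<^bsub>A\<^esub>\<^esub> y = x \<otimes>\<^bsub>A\<^esub> y"
proof -
  interpret comm_group A by fact
  show ?thesis using assms(2-) by (simp add: mult_inv_diff_diff del: inv_one)
qed

lemma elliptic_hom_twist_imp_hom:
  assumes "comm_group A" "a \<in> carrier A" "f \<in> elliptic_hom (twist A a) T"
  shows "f \<in> hom A (translation_group T (f \<one>\<^bsub>A\<^esub>))"
proof -
  interpret comm_group A by fact
  have "f \<in> hom (translation_group (twist A a) \<one>\<^bsub>A\<^esub>) (translation_group T (f \<one>\<^bsub>A\<^esub>))"
    using assms by (intro elliptic_hom_imp_hom elliptic_group_twist) auto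
  then show ?thesis
    using translation_group_twist_mult[OF assms(1,2)] by (simp add: hom_def)
qed

lemma hom_imp_elliptic_hom_twist:
  assumes "group A" "a \<in> carrier A" "elliptic_group E" "p \<in> carrier E"
    and h: "h \<in> hom A (translation_group E p)" and "h a = p \<star>\<^bsub>E\<^esub> p"
  shows "h \<in> elliptic_hom (twist A a) E"
proof -
  interpret A: group A by fact
  interpret E: elliptic_group E by fact
  interpret G: comm_group "translation_group E p"
    using assms(4) by (rule E.comm_group_translation_group)
  interpret h: group_hom A "translation_group E p" h by unfold_locales (fact h)
  have [simp]: "h x \<in> carrier E" if "x \<in> carrier A" for x using h.hom_closed[OF that] by simp
  show ?thesis
    unfolding elliptic_hom_def
    using assms(2,6) by (auto simp del: translation_group_simps(2)
      simp: E.op_eq_translation_group[OF assms(4)] simp flip: h.hom_inv)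
qed

lemma elliptic_hom_prod_twist:
  assumes "group X" "group Y"
  shows "elliptic_hom (elliptic_prod (twist X s) (twist Y t)) E =
    elliptic_hom (twist (X \<times>\<times> Y) (s, t)) E"
  using assms unfolding elliptic_hom_def by auto

lemma elliptic_coproduct_endo_id:
  assumes C: "is_elliptic_coproduct TYPE('c) P Q (C :: 'c elliptic) i j"
    and k: "k \<in> elliptic_hom C C" "\<forall>x\<in>carrier P. k (i x) = i x" "\<forall>y\<in>carrier Q. k (j y) = j y"
    and x: "x \<in> carrier C"
  shows "k x = x"
proof -
  have EC: "elliptic_group C" and i: "i \<in> elliptic_hom P C" and j: "j \<in> elliptic_hom Q C"
    using C unfolding is_elliptic_coproduct_def by auto
  define R where "R h \<longleftrightarrow> h \<in> elliptic_hom C C \<and> h \<in> extensional (carrier C) \<and>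
      (\<forall>x\<in>carrier P. i x = h (i x)) \<and> (\<forall>y\<in>carrier Q. j y = h (j y))" for h
  have "\<exists>!h. R h"
    using C EC i j unfolding is_elliptic_coproduct_def R_def by blast
  moreover have "R (restrict h (carrier C))"
    if "h \<in> elliptic_hom C C" "\<forall>x\<in>carrier P. h (i x) = i x" "\<forall>y\<in>carrier Q. h (j y) = j y" for h
    using that i j unfolding R_def elliptic_hom_def
    by (auto simp: elliptic_group.closed[OF EC] Pi_iff)
  moreover have "(\<lambda>x. x) \<in> elliptic_hom C C" unfolding elliptic_hom_def by auto
  ultimately have "restrict k (carrier C) = restrict (\<lambda>x. x) (carrier C)" using k by blast
  then show ?thesis using x by (metis restrict_apply')
qed

lemma elliptic_coproduct_unique:
  assumes "is_elliptic_coproduct TYPE('c) P Q (C :: 'c elliptic) i j"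
    and "is_elliptic_coproduct TYPE('d) P Q C i j"
    and "is_elliptic_coproduct TYPE('c) P Q (D :: 'd elliptic) i' j'"
    and "is_elliptic_coproduct TYPE('d) P Q D i' j'"
  shows "\<exists>\<phi>. \<phi> \<in> elliptic_iso C D"
proof -
  have EC: "elliptic_group C" and ED: "elliptic_group D"
    and i: "i \<in> elliptic_hom P C" and j: "j \<in> elliptic_hom Q C"
    and i': "i' \<in> elliptic_hom P D" and j': "j' \<in> elliptic_hom Q D"
    using assms unfolding is_elliptic_coproduct_def by auto
  obtain \<phi> where \<phi>: "\<phi> \<in> elliptic_hom C D" "\<forall>x\<in>carrier P. i' x = \<phi> (i x)" "\<forall>y\<in>carrier Q. j' y = \<phi> (j y)"
    using assms(2) ED i' j' unfolding is_elliptic_coproduct_def by metis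
  obtain \<psi> where \<psi>: "\<psi> \<in> elliptic_hom D C" "\<forall>x\<in>carrier P. i x = \<psi> (i' x)" "\<forall>y\<in>carrier Q. j y = \<psi> (j' y)"
    using assms(3) EC i j unfolding is_elliptic_coproduct_def by metis
  have "\<psi> (\<phi> x) = x" if "x \<in> carrier C" for x
    using that \<phi> \<psi> by (intro elliptic_coproduct_endo_id[OF assms(1), of "\<lambda>x. \<psi> (\<phi> x)"])
      (auto simp: elliptic_hom_def Pi_iff)
  moreover have "\<phi> (\<psi> y) = y" if "y \<in> carrier D" for y
    using that \<phi> \<psi> by (intro elliptic_coproduct_endo_id[OF assms(4), of "\<lambda>y. \<phi> (\<psi> y)"])
      (auto simp: elliptic_hom_def Pi_iff)
  ultimately have "bij_betw \<phi> (carrier C) (carrier D)"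
    using \<phi>(1) \<psi>(1) by (intro bij_betw_byWitness[where f' = \<psi>]) (auto simp: elliptic_hom_def)
  then show ?thesis using \<phi>(1) unfolding elliptic_iso_def by blast
qed

lemma hom_int_DirProd_eq:
  fixes B :: "('b, 'n) monoid_scheme" and A :: "('a, 'm) monoid_scheme"
  assumes "group B" "group A" "group G"
    and h: "h \<in> hom (integer_group \<times>\<times> (B \<times>\<times> A)) G"
    and "b \<in> carrier B" "x \<in> carrier A"
  shows "h (n, b, x) = h (1, \<one>\<^bsub>B\<^esub>, \<one>\<^bsub>A\<^esub>) [^]\<^bsub>G\<^esub> n \<otimes>\<^bsub>G\<^esub>
    (inv\<^bsub>G\<^esub> h (1, \<one>\<^bsub>B\<^esub>, \<one>\<^bsub>A\<^esub>) \<otimes>\<^bsub>G\<^esub> h (1, b, \<one>\<^bsub>A\<^esub>)) \<otimes>\<^bsub>G\<^esub> h (0, \<one>\<^bsub>B\<^esub>, x)"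
proof -
  interpret B: group B by fact
  interpret A: group A by fact
  interpret G: group G by fact
  interpret h: group_hom "integer_group \<times>\<times> (B \<times>\<times> A)" G h
    by (intro group_hom.intro group_hom_axioms.intro DirProd_group assms(1-4) group_integer_group)
  have "(\<lambda>n. (n, \<one>\<^bsub>B\<^esub>, \<one>\<^bsub>A\<^esub>)) \<in> hom integer_group (integer_group \<times>\<times> (B \<times>\<times> A))"
    by (auto simp: hom_def)
  then have "(\<lambda>n. h (n, \<one>\<^bsub>B\<^esub>, \<one>\<^bsub>A\<^esub>)) \<in> hom integer_group G"
    using hom_compose[OF _ h] by (simp add: comp_def)
  then have "h (n, \<one>\<^bsub>B\<^esub>, \<one>\<^bsub>A\<^esub>) = h (1, \<one>\<^bsub>B\<^esub>, \<one>\<^bsub>A\<^esub>) [^]\<^bsub>G\<^esub> n"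
    using hom_int_pow[of "\<lambda>n. h (n, \<one>\<^bsub>B\<^esub>, \<one>\<^bsub>A\<^esub>)" integer_group G 1 n] by simp
  moreover have "h (n, b, x) =
      h (n, \<one>\<^bsub>B\<^esub>, \<one>\<^bsub>A\<^esub>) \<otimes>\<^bsub>G\<^esub> (inv\<^bsub>G\<^esub> h (1, \<one>\<^bsub>B\<^esub>, \<one>\<^bsub>A\<^esub>) \<otimes>\<^bsub>G\<^esub> h (1, b, \<one>\<^bsub>A\<^esub>)) \<otimes>\<^bsub>G\<^esub> h (0, \<one>\<^bsub>B\<^esub>, x)"
    using assms by (simp add: DirProd_group flip: h.hom_inv h.hom_mult)
  ultimately show ?thesis by simp
qed

lemma is_elliptic_coproduct_twist:
  fixes A :: "('a, 'm) monoid_scheme" and B :: "('b, 'n) monoid_scheme" and a :: 'a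
  assumes A: "comm_group A" and B: "comm_group B" and a: "a \<in> carrier A"
  defines "P \<equiv> elliptic_prod (twist integer_group 1) (twist B \<one>\<^bsub>B\<^esub>)"
    and "Q \<equiv> twist A a"
    and "T \<equiv> twist (integer_group \<times>\<times> (B \<times>\<times> A)) (0, \<one>\<^bsub>B\<^esub>, a)"
    and "i \<equiv> (\<lambda>(n, b). (1 - 3 * n, b, a [^]\<^bsub>A\<^esub> n))"
    and "j \<equiv> (\<lambda>x. (0, \<one>\<^bsub>B\<^esub>, x))"
  shows "is_elliptic_coproduct TYPE('e) P Q T i j"
proof -
  interpret A: comm_group A by fact
  interpret B: comm_group B by fact
  let ?Z = "integer_group \<times>\<times> (B \<times>\<times> A)"
  note ab = abelian_integer_group comm_group_DirProd A B
  have Z: "comm_group ?Z" and ZB: "comm_group (integer_group \<times>\<times> B)" by (intro ab)+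
  have zero: "(0, \<one>\<^bsub>B\<^esub>, a) \<in> carrier ?Z" using a by simp
  have EP: "elliptic_group P" and EQ: "elliptic_group Q" and ET: "elliptic_group T"
    unfolding P_def Q_def T_def using a zero
    by (auto intro!: elliptic_group_prod elliptic_group_twist Z ab)
  have pow: "a [^]\<^bsub>A\<^esub> (1 - n - m) = a \<otimes>\<^bsub>A\<^esub> inv\<^bsub>A\<^esub> (a [^]\<^bsub>A\<^esub> n) \<otimes>\<^bsub>A\<^esub> inv\<^bsub>A\<^esub> (a [^]\<^bsub>A\<^esub> m)" for n m :: int
    using a by (simp add: A.int_pow_diff)
  have i: "i \<in> elliptic_hom P T" and j: "j \<in> elliptic_hom Q T"
    using a unfolding P_def Q_def T_def i_def j_def elliptic_hom_def
    by (auto simp: pow[simplified] DirProd_group)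
  have PE: "elliptic_hom P E = elliptic_hom (twist (integer_group \<times>\<times> B) (1, \<one>\<^bsub>B\<^esub>)) E" for E :: "'e elliptic"
    unfolding P_def by (intro elliptic_hom_prod_twist) auto
  have "\<exists>!h. h \<in> elliptic_hom T E \<and> h \<in> extensional (carrier T) \<and>
      (\<forall>x\<in>carrier P. f x = h (i x)) \<and> (\<forall>y\<in>carrier Q. g y = h (j y))"
    if E: "elliptic_group E" and f: "f \<in> elliptic_hom P E" and g: "g \<in> elliptic_hom Q E"
    for E :: "'e elliptic" and f g
  proof -
    interpret E: elliptic_group E by fact
    define c where "c = g \<one>\<^bsub>A\<^esub>"
    define p where "p = f (0, \<one>\<^bsub>B\<^esub>)"
    define G where "G = translation_group E c"
    have c: "c \<in> carrier E" and p: "p \<in> carrier E"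
      using f g unfolding c_def p_def elliptic_hom_def P_def Q_def by auto
    interpret G: comm_group G unfolding G_def using c by (rule E.comm_group_translation_group)
    have GE: "carrier G = carrier E" "\<one>\<^bsub>G\<^esub> = c" by (simp_all add: G_def)
    have op: "x \<star>\<^bsub>E\<^esub> y = (c \<star>\<^bsub>E\<^esub> c) \<otimes>\<^bsub>G\<^esub> inv\<^bsub>G\<^esub> x \<otimes>\<^bsub>G\<^esub> inv\<^bsub>G\<^esub> y" if "x \<in> carrier G" "y \<in> carrier G" for x y
      unfolding G_def using E.op_eq_translation_group[OF c] that GE by simp
    have cc: "c \<star>\<^bsub>E\<^esub> c \<in> carrier G" using c E.closed GE by simp
    have pG: "p \<in> carrier G" using p GE by simp
    have g_hom: "g \<in> hom A G"
      using elliptic_hom_twist_imp_hom[OF A a, of g E] g unfolding Q_def G_def c_def by simp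
    interpret g: group_hom A G g by unfold_locales (fact g_hom)
    have ga: "g a = c \<star>\<^bsub>E\<^esub> c"
    proof -
      have "g (\<one>\<^bsub>A\<^esub> \<star>\<^bsub>Q\<^esub> \<one>\<^bsub>A\<^esub>) = c \<star>\<^bsub>E\<^esub> c"
        using g unfolding elliptic_hom_def c_def Q_def by (simp del: g.hom_one twist_simps(2))
      then show ?thesis using a by (simp add: Q_def)
    qed
    define k where "k x = f x \<otimes>\<^bsub>G\<^esub> inv\<^bsub>G\<^esub> p" for x
    have "f \<in> hom (integer_group \<times>\<times> B) (translation_group E p)"
      using elliptic_hom_twist_imp_hom[OF ZB, of "(1, \<one>\<^bsub>B\<^esub>)" f E] f unfolding PE p_def by simp
    from hom_compose[OF this E.translation_group_hom[OF c p, folded G_def]]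
    have k_hom: "k \<in> hom (integer_group \<times>\<times> B) G" by (simp add: comp_def k_def[abs_def])
    interpret k: group_hom "integer_group \<times>\<times> B" G k
      using ZB by (intro group_hom.intro group_hom_axioms.intro k_hom G.group_axioms) (rule comm_group.axioms)
    have f_carr: "f x \<in> carrier G" if "x \<in> carrier P" for x
      using f that unfolding elliptic_hom_def GE by auto
    have k1: "k (1, \<one>\<^bsub>B\<^esub>) = (c \<star>\<^bsub>E\<^esub> c) \<otimes>\<^bsub>G\<^esub> inv\<^bsub>G\<^esub> (p [^]\<^bsub>G\<^esub> (3::int))"
    proof -
      have "f ((0, \<one>\<^bsub>B\<^esub>) \<star>\<^bsub>P\<^esub> (0, \<one>\<^bsub>B\<^esub>)) = p \<star>\<^bsub>E\<^esub> p"
        using f unfolding elliptic_hom_def p_def P_def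
        by (simp del: twist_simps(2) elliptic_prod_simps(2))
      then have "f (1, \<one>\<^bsub>B\<^esub>) = p \<star>\<^bsub>E\<^esub> p" by (simp add: P_def)
      moreover have "p [^]\<^bsub>G\<^esub> (3::int) = p \<otimes>\<^bsub>G\<^esub> p \<otimes>\<^bsub>G\<^esub> p"
        using pG G.int_pow_mult[OF pG, of 1 1] G.int_pow_mult[OF pG, of 2 1] by simp
      ultimately show ?thesis
        using pG cc op[OF pG pG] by (simp add: k_def G.inv_mult G.m_ac)
    qed
    have k_eq: "k (n, b) = k (1, \<one>\<^bsub>B\<^esub>) [^]\<^bsub>G\<^esub> n \<otimes>\<^bsub>G\<^esub> k (0, b)" if "b \<in> carrier B" for n b
    proof -
      have "(\<lambda>n. (n, \<one>\<^bsub>B\<^esub>)) \<in> hom integer_group (integer_group \<times>\<times> B)" by (auto simp: hom_def)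
      from hom_compose[OF this k_hom]
      have "k (n, \<one>\<^bsub>B\<^esub>) = k (1, \<one>\<^bsub>B\<^esub>) [^]\<^bsub>G\<^esub> n"
        using hom_int_pow[of "\<lambda>n. k (n, \<one>\<^bsub>B\<^esub>)" integer_group G 1 n] by (simp add: comp_def)
      moreover have "k (n, b) = k (n, \<one>\<^bsub>B\<^esub>) \<otimes>\<^bsub>G\<^esub> k (0, b)"
        using that by (simp flip: k.hom_mult)
      ultimately show ?thesis by simp
    qed
    define h where "h = (\<lambda>(n :: int, b, x). p [^]\<^bsub>G\<^esub> n \<otimes>\<^bsub>G\<^esub> k (0, b) \<otimes>\<^bsub>G\<^esub> g x)"
    have k0: "k (0, b) \<in> carrier G" if "b \<in> carrier B" for b using that by simp
    have k0m: "k (0, b \<otimes>\<^bsub>B\<^esub> b') = k (0, b) \<otimes>\<^bsub>G\<^esub> k (0, b')" if "b \<in> carrier B" "b' \<in> carrier B" for b b'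
      using that by (simp flip: k.hom_mult)
    have k01: "k (0, \<one>\<^bsub>B\<^esub>) = \<one>\<^bsub>G\<^esub>" using k.hom_one by simp
    have "h \<in> hom ?Z G"
      using pG unfolding h_def hom_def by (auto simp: k0m k0 G.m_ac G.int_pow_mult)
    moreover have "h (0, \<one>\<^bsub>B\<^esub>, a) = c \<star>\<^bsub>E\<^esub> c"
      using cc by (simp add: h_def k01 ga)
    ultimately have hT: "h \<in> elliptic_hom T E"
      unfolding T_def G_def using Z zero E c
      by (intro hom_imp_elliptic_hom_twist[where p = c]) (auto simp: comm_group.axioms)
    have hi: "f x = h (i x)" if xP: "x \<in> carrier P" for x
    proof -
      obtain n b where x: "x = (n, b)" "b \<in> carrier B" using xP by (cases x) (auto simp: P_def)
      have "f x = k x \<otimes>\<^bsub>G\<^esub> p"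
        using pG f_carr[OF that] by (simp add: k_def G.m_assoc)
      also have "k x = k (1, \<one>\<^bsub>B\<^esub>) [^]\<^bsub>G\<^esub> n \<otimes>\<^bsub>G\<^esub> k (0, b)"
        unfolding x(1) using x(2) by (rule k_eq)
      also have "k (1, \<one>\<^bsub>B\<^esub>) [^]\<^bsub>G\<^esub> n = (c \<star>\<^bsub>E\<^esub> c) [^]\<^bsub>G\<^esub> n \<otimes>\<^bsub>G\<^esub> inv\<^bsub>G\<^esub> (p [^]\<^bsub>G\<^esub> (3 * n))"
        unfolding k1 using pG cc
        by (simp only: G.int_pow_distrib G.int_pow_inv G.int_pow_pow G.int_pow_closed G.inv_closed)
      also have "(c \<star>\<^bsub>E\<^esub> c) [^]\<^bsub>G\<^esub> n = g (a [^]\<^bsub>A\<^esub> n)"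
        using a by (simp add: g.hom_int_pow ga)
      also have "g (a [^]\<^bsub>A\<^esub> n) \<otimes>\<^bsub>G\<^esub> inv\<^bsub>G\<^esub> (p [^]\<^bsub>G\<^esub> (3 * n)) \<otimes>\<^bsub>G\<^esub> k (0, b) \<otimes>\<^bsub>G\<^esub> p =
          (p \<otimes>\<^bsub>G\<^esub> inv\<^bsub>G\<^esub> (p [^]\<^bsub>G\<^esub> (3 * n))) \<otimes>\<^bsub>G\<^esub> k (0, b) \<otimes>\<^bsub>G\<^esub> g (a [^]\<^bsub>A\<^esub> n)"
        using x pG k0[of b] a by (simp add: G.m_ac)
      also have "\<dots> = h (i x)"
        using x pG by (simp add: h_def i_def G.int_pow_diff)
      finally show ?thesis .
    qed
    have hj: "g y = h (j y)" if "y \<in> carrier Q" for y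
      using that k01 by (simp add: h_def j_def Q_def)
    have unique: "u t = h t"
      if u: "u \<in> elliptic_hom T E" "\<forall>x\<in>carrier P. f x = u (i x)" "\<forall>y\<in>carrier Q. g y = u (j y)"
        and t: "t \<in> carrier T" for u t
    proof -
      have hom_eq: "v (n, b, x) = f (0, \<one>\<^bsub>B\<^esub>) [^]\<^bsub>G\<^esub> n \<otimes>\<^bsub>G\<^esub>
          (inv\<^bsub>G\<^esub> f (0, \<one>\<^bsub>B\<^esub>) \<otimes>\<^bsub>G\<^esub> f (0, b)) \<otimes>\<^bsub>G\<^esub> g x"
        if v: "v \<in> elliptic_hom T E" "\<forall>x\<in>carrier P. f x = v (i x)" "\<forall>y\<in>carrier Q. g y = v (j y)"
          and "b \<in> carrier B" "x \<in> carrier A" for v n b x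
      proof -
        have vf: "v (1, b', \<one>\<^bsub>A\<^esub>) = f (0, b')" if "b' \<in> carrier B" for b'
          using v(2)[rule_format, of "(0, b')"] that by (simp add: i_def P_def)
        have vg: "v (0, \<one>\<^bsub>B\<^esub>, y) = g y" if "y \<in> carrier A" for y
          using v(3) that by (simp add: j_def Q_def)
        have "v \<in> hom ?Z (translation_group E (v \<one>\<^bsub>?Z\<^esub>))"
          using elliptic_hom_twist_imp_hom[OF Z zero] v(1) unfolding T_def by blast
        moreover have "v \<one>\<^bsub>?Z\<^esub> = c" using vg[of "\<one>\<^bsub>A\<^esub>"] unfolding c_def by simp
        ultimately have "v \<in> hom ?Z G" unfolding G_def by simp
        from hom_int_DirProd_eq[OF B.group_axioms A.group_axioms G.group_axioms this that(4,5)]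
        show ?thesis unfolding vf[OF B.one_closed] vf[OF that(4)] vg[OF that(5)] .
      qed
      obtain n b x where "t = (n, b, x)" "b \<in> carrier B" "x \<in> carrier A"
        using t by (cases t) (auto simp: T_def)
      then show ?thesis
        using hom_eq[OF u] hom_eq[OF hT] hi hj by metis
    qed
    show ?thesis
    proof (rule ex1I[of _ "restrict h (carrier T)"], safe)
      show "restrict h (carrier T) \<in> elliptic_hom T E"
        using hT elliptic_group.closed[OF ET] unfolding elliptic_hom_def by auto
      fix x assume "x \<in> carrier P"
      then show "f x = restrict h (carrier T) (i x)"
        using hi i unfolding elliptic_hom_def by auto
    next
      fix y assume "y \<in> carrier Q"
      then show "g y = restrict h (carrier T) (j y)"
        using hj j unfolding elliptic_hom_def by auto
    next
      fix u assume "u \<in> elliptic_hom T E" "u \<in> extensional (carrier T)"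
        "\<forall>x\<in>carrier P. f x = u (i x)" "\<forall>y\<in>carrier Q. g y = u (j y)"
      then show "u = restrict h (carrier T)"
        using unique by (intro extensionalityI[of _ "carrier T"]) auto
    qed simp
  qed
  then show ?thesis
    unfolding is_elliptic_coproduct_def using EP EQ ET i j by blast
qed

theorem proposition10p2:
  fixes A :: "('a, 'm) monoid_scheme" and B :: "('b, 'n) monoid_scheme" and a :: 'a
  assumes "comm_group A" and "comm_group B" and "a \<in> carrier A"
  defines "P \<equiv> elliptic_prod (twist integer_group 1) (twist B \<one>\<^bsub>B\<^esub>)"
    and "Q \<equiv> twist A a"
    and "T \<equiv> twist (integer_group \<times>\<times> (B \<times>\<times> A)) (0, \<one>\<^bsub>B\<^esub>, a)"
    and "i \<equiv> (\<lambda>(n, b). (1 - 3 * n, b, a [^]\<^bsub>A\<^esub> n))"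
    and "j \<equiv> (\<lambda>x. (0, \<one>\<^bsub>B\<^esub>, x))"
  shows "is_elliptic_coproduct TYPE('e) P Q T i j \<and>
    (\<forall>(C :: 'c elliptic) i' j'.
      is_elliptic_coproduct TYPE('c) P Q C i' j' \<and>
      is_elliptic_coproduct TYPE(int \<times> 'b \<times> 'a) P Q C i' j' \<longrightarrow>
      (\<exists>\<phi>. \<phi> \<in> elliptic_iso C T))"
proof (intro conjI allI impI)
  have T: "is_elliptic_coproduct TYPE('e) P Q T i j"
    and Tc: "is_elliptic_coproduct TYPE('c) P Q T i j"
    and Tt: "is_elliptic_coproduct TYPE(int \<times> 'b \<times> 'a) P Q T i j"
    unfolding P_def Q_def T_def i_def j_def
    by (rule is_elliptic_coproduct_twist[OF assms(1-3)])+
  show "is_elliptic_coproduct TYPE('e) P Q T i j" by (fact T)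
  fix C :: "'c elliptic" and i' j'
  assume "is_elliptic_coproduct TYPE('c) P Q C i' j' \<and>
    is_elliptic_coproduct TYPE(int \<times> 'b \<times> 'a) P Q C i' j'"
  then show "\<exists>\<phi>. \<phi> \<in> elliptic_iso C T"
    using elliptic_coproduct_unique[OF _ _ Tc Tt] by blast
qed

end
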